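(* For $n\in\mathbb{N}$, let $\underline{A}=(A_0,\ldots,A_n)$ and $\underline{B}=(B_0,\ldots,B_n)$ be finite sequences of variables. Then in the polynomial semiring $\mathbb{N}[\underline{A},\underline{B},X,Y]$, we have $$\sum_{i=0}^n\left(A_i\sum_{j=0}^nB_jY^j+B_i\sum_{j=0}^nA_jX^j\right)\left(\sum_{k=1}^iX^{i-k}Y^{k-1}\right)=\sum_{i=0}^n\left(A_i\sum_{j=0}^nB_jX^j+B_i\sum_{j=0}^nA_jY^j\right)\left(\sum_{k=1}^iX^{i-k}Y^{k-1}\right).$$
   Context: $\mathbb{N}[\underline{A},\underline{B},X,Y]$ is the semiring of polynomials with natural number coefficients in the commuting variables $A_0,\ldots,A_n,B_0,\ldots,B_n,X,Y$. Empty sums (for $i=0$ in $\sum_{k=1}^i$) are $0$. *)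

theory Defs
  imports Main "HOL-Library.Poly_Mapping"
begin

text \<open>
  A monomial is a finitely supported exponent function on the variables, a polynomial a finitely
  supported map from monomials to coefficients; the product from \<^theory>\<open>HOL-Library.Poly_Mapping\<close>
  is the convolution product.

  The variables \<open>A\<^sub>i\<close>, \<open>B\<^sub>i\<close> are available for all natural numbers \<open>i\<close>.
  The polynomial semiring in \<open>A\<^sub>0, \<dots>, A\<^sub>n, B\<^sub>0, \<dots>, B\<^sub>n, X, Y\<close> is the subsemiring of those
  polynomials in which no other variable occurs. An identity between its elements
  means the same in it as in the ambient semiring.
\<close>

datatype var = VarA nat | VarB nat | VarX | VarY

type_synonym 'c mpoly = "(var \<Rightarrow>\<^sub>0 nat) \<Rightarrow>\<^sub>0 'c"

definition indet :: "var \<Rightarrow> nat mpoly" where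
  "indet v = Poly_Mapping.single (Poly_Mapping.single v 1) 1"

abbreviation A :: "nat \<Rightarrow> nat mpoly" where "A i \<equiv> indet (VarA i)"
abbreviation B :: "nat \<Rightarrow> nat mpoly" where "B i \<equiv> indet (VarB i)"
abbreviation X :: "nat mpoly" where "X \<equiv> indet VarX"
abbreviation Y :: "nat mpoly" where "Y \<equiv> indet VarY"

end

theory Submission
  imports Defs
begin

text \<open>
  Write \<open>h\<^sub>i = \<Sum>k=1..i. X\<^sup>i\<^sup>-\<^sup>k Y\<^sup>k\<^sup>-\<^sup>1\<close>, the complete homogeneous polynomial of degree \<open>i - 1\<close>
  in two variables, i.e. \<open>(X\<^sup>i - Y\<^sup>i) / (X - Y)\<close>. On the left-hand side the product \<open>A\<^sub>i B\<^sub>j\<close> has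
  the coefficient \<open>Y\<^sup>j h\<^sub>i + X\<^sup>i h\<^sub>j\<close>. This is \<open>h\<^sub>i\<^sub>+\<^sub>j\<close>, as the quotient shows by telescoping; lemma
  \<open>divided_power_add\<close> obtains it without subtraction, which the natural numbers lack.
  Hence the left-hand side is \<open>\<Sum>i j. A\<^sub>i B\<^sub>j h\<^sub>i\<^sub>+\<^sub>j\<close> (lemma \<open>mixed_sum_eq_Hankel_form\<close>), a bilinear
  form with a Hankel matrix and therefore symmetric in the two sequences. Exchanging \<open>A\<close> and \<open>B\<close>
  on the left-hand side yields the right-hand side.
\<close>

definition divided_power :: "'a::comm_semiring_1 \<Rightarrow> 'a \<Rightarrow> nat \<Rightarrow> 'a" where
  "divided_power x y i = (\<Sum>k=1..i. x ^ (i - k) * y ^ (k - 1))"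

text \<open>
  The monomials of \<open>divided_power x y (i + j)\<close> are split by their exponent of \<open>y\<close>: those with
  exponent below \<open>j\<close> are divisible by \<open>x ^ i\<close>, the others by \<open>y ^ j\<close>.
\<close>

lemma divided_power_add:
  "divided_power x y (i + j) = x ^ i * divided_power x y j + y ^ j * divided_power x y i"
proof -
  let ?t = "\<lambda>k. x ^ (i + j - k) * y ^ (k - 1)"
  have "divided_power x y (i + j) = sum ?t {1..j} + sum ?t {j + 1..j + i}"
    unfolding divided_power_def add.commute[of i j] by (rule sum.ub_add_nat) simp
  also have "sum ?t {1..j} = x ^ i * divided_power x y j"
    unfolding divided_power_def sum_distrib_left
  proof (rule sum.cong)
    fix k assume "k \<in> {1..j}"
    then have "i + j - k = i + (j - k)" by auto
    then show "?t k = x ^ i * (x ^ (j - k) * y ^ (k - 1))"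
      by (simp only: power_add mult.assoc)
  qed simp
  also have "sum ?t {j + 1..j + i} = (\<Sum>k=1..i. ?t (k + j))"
    using sum.shift_bounds_cl_nat_ivl[of ?t 1 j i] by (simp add: add.commute)
  also have "\<dots> = y ^ j * divided_power x y i"
    unfolding divided_power_def sum_distrib_left
  proof (rule sum.cong)
    fix k assume "k \<in> {1..i}"
    then have "k + j - 1 = j + (k - 1)" "i + j - (k + j) = i - k" by auto
    then show "?t (k + j) = y ^ j * (x ^ (i - k) * y ^ (k - 1))"
      by (simp only: power_add mult.left_commute)
  qed simp
  finally show ?thesis .
qed

lemma mixed_sum_eq_Hankel_form:
  fixes a b :: "nat \<Rightarrow> 'a::comm_semiring_1"
  shows "(\<Sum>i\<in>S. (a i * (\<Sum>j\<in>S. b j * y ^ j) + b i * (\<Sum>j\<in>S. a j * x ^ j)) * divided_power x y i)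
       = (\<Sum>i\<in>S. \<Sum>j\<in>S. a i * b j * divided_power x y (i + j))"
    (is "?lhs = ?rhs")
proof -
  have "?lhs = (\<Sum>i\<in>S. \<Sum>j\<in>S. a i * b j * (y ^ j * divided_power x y i))
             + (\<Sum>i\<in>S. \<Sum>j\<in>S. a j * b i * (x ^ j * divided_power x y i))"
    by (simp only: distrib_right sum.distrib sum_distrib_left sum_distrib_right)
      (simp only: mult_ac)
  also have "(\<Sum>i\<in>S. \<Sum>j\<in>S. a j * b i * (x ^ j * divided_power x y i))
           = (\<Sum>i\<in>S. \<Sum>j\<in>S. a i * b j * (x ^ i * divided_power x y j))"
    by (rule sum.swap)
  finally show ?thesis
    by (simp add: divided_power_add distrib_left sum.distrib add.commute)
qed

lemma Hankel_form_commute: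
  fixes a b h :: "nat \<Rightarrow> 'a::comm_semiring_1"
  shows "(\<Sum>i\<in>S. \<Sum>j\<in>S. a i * b j * h (i + j)) = (\<Sum>i\<in>S. \<Sum>j\<in>S. b i * a j * h (i + j))"
  by (subst sum.swap) (simp only: add.commute mult.commute)

theorem lemma5p1:
  fixes n :: nat
  shows "(\<Sum>i=0..n. (A i * (\<Sum>j=0..n. B j * Y ^ j) + B i * (\<Sum>j=0..n. A j * X ^ j))
                    * (\<Sum>k=1..i. X ^ (i - k) * Y ^ (k - 1)))
       = (\<Sum>i=0..n. (A i * (\<Sum>j=0..n. B j * X ^ j) + B i * (\<Sum>j=0..n. A j * Y ^ j))
                    * (\<Sum>k=1..i. X ^ (i - k) * Y ^ (k - 1)))"
proof -
  have "(\<Sum>i=0..n. (A i * (\<Sum>j=0..n. B j * Y ^ j) + B i * (\<Sum>j=0..n. A j * X ^ j))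
                    * divided_power X Y i)
      = (\<Sum>i=0..n. (B i * (\<Sum>j=0..n. A j * Y ^ j) + A i * (\<Sum>j=0..n. B j * X ^ j))
                    * divided_power X Y i)"
    unfolding mixed_sum_eq_Hankel_form by (rule Hankel_form_commute)
  also have "\<dots> = (\<Sum>i=0..n. (A i * (\<Sum>j=0..n. B j * X ^ j) + B i * (\<Sum>j=0..n. A j * Y ^ j))
                    * divided_power X Y i)"
    by (simp only: add.commute)
  finally show ?thesis
    unfolding divided_power_def .
qed

end
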